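(* Let $\mathcal M=(M,\rho)$ be a six-point metric space, $M=\{p_1,\dots,p_6\}$, $d_{ij}=\rho(p_i,p_j)$. Let $G$ be the binary tree with boundary $M$ having exactly two moustaches $\{p_1,p_2\}$ and $\{p_5,p_6\}$, whose three interior edges generate the partitions $\{p_1,p_2\}\sqcup\{p_3,p_4,p_5,p_6\}$, $\{p_1,p_2,p_3\}\sqcup\{p_4,p_5,p_6\}$ and $\{p_1,p_2,p_3,p_4\}\sqcup\{p_5,p_6\}$ of $M$. Then the polyhedral set $\Lambda_G$ is a $6$-dimensional convex polyhedron in $\mathbb R^{15}$ with exactly $8$ vertices, namely (coordinates $\lambda_{ij}$, $i<j$, ordered lexicographically) $$\tfrac12(1,0,0,0,1,1,0,0,0,1,0,0,1,0,1),\quad \tfrac12(1,1,0,0,0,0,0,0,1,1,0,0,1,0,1),$$ $$\tfrac12(1,0,1,0,0,1,0,0,0,0,0,1,1,0,1),\quad \tfrac12(1,1,0,0,0,0,1,0,0,0,0,1,1,0,1),$$ $$\tfrac12(1,0,0,1,0,1,0,0,0,1,0,0,0,1,1),\quad \tfrac12(1,1,0,0,0,0,0,1,0,1,0,0,0,1,1),$$ $$\tfrac12(1,0,1,0,0,1,0,0,0,0,1,0,0,1,1),\quad \tfrac12(1,1,0,0,0,0,1,0,0,0,1,0,0,1,1),$$ and the weight $\mathrm{mpf}_{-}(\mathcal M,G)$ of the generalized minimal parametric filling of type $G$ of $\mathcal M$ is equal to the maximum of the eight values $$\tfrac12(d_{12}+d_{16}+d_{23}+d_{34}+d_{45}+d_{56}),\quad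 \tfrac12(d_{12}+d_{13}+d_{26}+d_{34}+d_{45}+d_{56}),$$ $$\tfrac12(d_{12}+d_{14}+d_{23}+d_{36}+d_{45}+d_{56}),\quad \tfrac12(d_{12}+d_{13}+d_{24}+d_{36}+d_{45}+d_{56}),$$ $$\tfrac12(d_{12}+d_{15}+d_{23}+d_{34}+d_{46}+d_{56}),\quad \tfrac12(d_{12}+d_{13}+d_{25}+d_{34}+d_{46}+d_{56}),$$ $$\tfrac12(d_{12}+d_{14}+d_{23}+d_{35}+d_{46}+d_{56}),\quad \tfrac12(d_{12}+d_{13}+d_{24}+d_{35}+d_{46}+d_{56}).$$
   Context: A binary tree is a finite tree all of whose vertices have degree $1$ or $3$; its boundary is the set of all its vertices of degree $1$. Moustaches of a binary tree are a pair of boundary vertices having a common neighbouring vertex. An interior edge is an edge not incident to a boundary vertex. Let $G=(V,E)$ be a binary tree with boundary $M=\{p_1,\dots,p_n\}$. For $i<j$ let $\gamma(i,j)$ denote the unique path in $G$ joining $p_i$ and $p_j$. A function $\omega\colon E\to\mathbb R$ (negative values allowed) makes $G$ a generalized filling of $\mathcal M$ if $\sum_{e\in\gamma(i,j)}\omega(e)\ge d_{ij}$ for all $1\le i<j\le n$. Then $\mathrm{mpf}_{-}(\mathcal M,G)$ is the infimum of $\sum_{e\in E}\omega(e)$ over all such $\omega$. Each edge $e\in E$ generates a partition $\mathcal P_G(e)=\{M_1,M_2\}$ of $M$, where $M_1,M_2$ are the sets of elements of $M$ lying in the two connected components obtained by deleting $e$ from $G$. The set $\Lambda_G\subset\mathbb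 R^{n(n-1)/2}$ consists of all vectors $\lambda=(\lambda_{ij})_{1\le i<j\le n}$ with $\lambda_{ij}\ge0$ and, for every $e\in E$, $\sum\lambda_{ij}=1$, where the sum is over all $i<j$ such that $p_i$ and $p_j$ lie in different elements of $\mathcal P_G(e)$. *)

theory Defs
  imports "HOL-Analysis.Analysis"
begin

text \<open>Finite simple graphs are given by a vertex set and a set of two-element sets of vertices.\<close>

definition simple_graph :: "'v set \<Rightarrow> 'v set set \<Rightarrow> bool" where
  "simple_graph V E \<longleftrightarrow>
     finite V \<and> V \<noteq> {} \<and> (\<forall>e\<in>E. \<exists>u\<in>V. \<exists>v\<in>V. u \<noteq> v \<and> e = {u, v})"

definition adj :: "'v set set \<Rightarrow> ('v \<times> 'v) set" where
  "adj E = {(u, v). {u, v} \<in> E}"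

definition connected_graph :: "'v set \<Rightarrow> 'v set set \<Rightarrow> bool" where
  "connected_graph V E \<longleftrightarrow> (\<forall>u\<in>V. \<forall>v\<in>V. (u, v) \<in> (adj E)\<^sup>*)"

definition graph_path :: "'v set \<Rightarrow> 'v set set \<Rightarrow> 'v list \<Rightarrow> bool" where
  "graph_path V E xs \<longleftrightarrow>
     xs \<noteq> [] \<and> set xs \<subseteq> V \<and> distinct xs \<and> successively (\<lambda>u v. {u, v} \<in> E) xs"

definition graph_cycle :: "'v set \<Rightarrow> 'v set set \<Rightarrow> 'v list \<Rightarrow> bool" where
  "graph_cycle V E xs \<longleftrightarrow> graph_path V E xs \<and> 3 \<le> length xs \<and> {last xs, hd xs} \<in> E"

definition tree :: "'v set \<Rightarrow> 'v set set \<Rightarrow> bool" where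
  "tree V E \<longleftrightarrow> simple_graph V E \<and> connected_graph V E \<and> (\<nexists>xs. graph_cycle V E xs)"

definition vertex_degree :: "'v set set \<Rightarrow> 'v \<Rightarrow> nat" where
  "vertex_degree E v = card {e \<in> E. v \<in> e}"

definition binary_tree :: "'v set \<Rightarrow> 'v set set \<Rightarrow> bool" where
  "binary_tree V E \<longleftrightarrow> tree V E \<and> (\<forall>v\<in>V. vertex_degree E v = 1 \<or> vertex_degree E v = 3)"

definition boundary :: "'v set \<Rightarrow> 'v set set \<Rightarrow> 'v set" where
  "boundary V E = {v \<in> V. vertex_degree E v = 1}"

definition moustaches :: "'v set \<Rightarrow> 'v set set \<Rightarrow> 'v set set" where
  "moustaches V E = {{u, v} | u v. u \<in> boundary V E \<and> v \<in> boundary V E \<and> u \<noteq> v \<and>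
                                   (\<exists>w\<in>V. {u, w} \<in> E \<and> {v, w} \<in> E)}"

definition interior_edges :: "'v set \<Rightarrow> 'v set set \<Rightarrow> 'v set set" where
  "interior_edges V E = {e \<in> E. e \<inter> boundary V E = {}}"

text \<open>The edges of the path joining \<open>u\<close> and \<open>v\<close>; this path is unique when the graph is a tree.\<close>

definition path_edges :: "'v set \<Rightarrow> 'v set set \<Rightarrow> 'v \<Rightarrow> 'v \<Rightarrow> 'v set set" where
  "path_edges V E u v =
     (let xs = (THE xs. graph_path V E xs \<and> hd xs = u \<and> last xs = v)
      in {{xs ! i, xs ! Suc i} | i. Suc i < length xs})"

text \<open>In what follows \<open>p 1, \<dots>, p n\<close> enumerate the boundary; the value \<open>p i\<close> is irrelevant for
  other \<open>i\<close>, and so is a weight function outside \<open>E\<close>.\<close>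

definition generalized_filling ::
  "'v set \<Rightarrow> 'v set set \<Rightarrow> nat \<Rightarrow> (nat \<Rightarrow> 'v) \<Rightarrow> ('v \<Rightarrow> 'v \<Rightarrow> real) \<Rightarrow> ('v set \<Rightarrow> real) \<Rightarrow> bool" where
  "generalized_filling V E n p \<rho> \<omega> \<longleftrightarrow>
     (\<forall>i j. 1 \<le> i \<and> i < j \<and> j \<le> n \<longrightarrow> \<rho> (p i) (p j) \<le> (\<Sum>e\<in>path_edges V E (p i) (p j). \<omega> e))"

text \<open>The infimum is taken in the extended reals, so that a real value of \<open>mpf_minus\<close> is a
  genuine infimum of a nonempty set that is bounded below.\<close>

definition mpf_minus ::
  "'v set \<Rightarrow> 'v set set \<Rightarrow> nat \<Rightarrow> (nat \<Rightarrow> 'v) \<Rightarrow> ('v \<Rightarrow> 'v \<Rightarrow> real) \<Rightarrow> ereal" where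
  "mpf_minus V E n p \<rho> =
     (INF \<omega>\<in>{\<omega>. generalized_filling V E n p \<rho> \<omega>}. ereal (\<Sum>e\<in>E. \<omega> e))"

definition graph_components :: "'v set \<Rightarrow> 'v set set \<Rightarrow> 'v set set" where
  "graph_components V E = {{v \<in> V. (u, v) \<in> (adj E)\<^sup>*} | u. u \<in> V}"

definition edge_partition :: "'v set \<Rightarrow> 'v set set \<Rightarrow> 'v set \<Rightarrow> 'v set set" where
  "edge_partition V E e = {C \<inter> boundary V E | C. C \<in> graph_components V (E - {e})}"

definition separates :: "'v set \<Rightarrow> 'v set set \<Rightarrow> 'v set \<Rightarrow> 'v \<Rightarrow> 'v \<Rightarrow> bool" where
  "separates V E e u v \<longleftrightarrow>
     (\<exists>A\<in>edge_partition V E e. \<exists>B\<in>edge_partition V E e. A \<noteq> B \<and> u \<in> A \<and> v \<in> B)"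

text \<open>Coordinates \<open>\<lambda>\<^sub>i\<^sub>j\<close>, \<open>1 \<le> i < j \<le> 6\<close>, are indexed by a type of pairs, so that the
  ambient space of dimension 15 is an instance of the class \<open>euclidean_space\<close>.\<close>

typedef pair6 = "{(i, j). 1 \<le> i \<and> i < j \<and> j \<le> 6} :: (nat \<times> nat) set"
proof
  show "(1, 2) \<in> {(i, j). 1 \<le> i \<and> i < j \<and> j \<le> (6::nat)}" by simp
qed

definition pairs_lex :: "(nat \<times> nat) list" where
  "pairs_lex =
     [(1,2), (1,3), (1,4), (1,5), (1,6), (2,3), (2,4), (2,5), (2,6), (3,4), (3,5), (3,6),
      (4,5), (4,6), (5,6)]"

lemma set_pairs_lex: "set pairs_lex = {(i, j). 1 \<le> i \<and> i < j \<and> j \<le> 6}"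
proof -
  have "{(i, j). 1 \<le> i \<and> i < j \<and> j \<le> (6::nat)} = (SIGMA i:{1..6}. {i<..6})"
    by auto
  also have "\<dots> = set pairs_lex"
    unfolding pairs_lex_def by code_simp
  finally show ?thesis ..
qed

instance pair6 :: finite
proof
  have "finite (Rep_pair6 ` UNIV)"
    using set_pairs_lex finite_set[of pairs_lex] type_definition.Rep_range[OF type_definition_pair6]
    by metis
  thus "finite (UNIV :: pair6 set)"
    by (rule finite_imageD) (simp add: inj_on_def Rep_pair6_inject)
qed

lemma card_pair6: "CARD(pair6) = 15"
proof -
  have "CARD(pair6) = card (set pairs_lex)"
    unfolding set_pairs_lex by (rule type_definition.card[OF type_definition_pair6])
  also have "\<dots> = 15" by (simp add: pairs_lex_def)
  finally show ?thesis .
qed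

text \<open>The vector whose coordinates in lexicographic order form the given list of length 15.\<close>

definition vec_lex :: "real list \<Rightarrow> real ^ pair6" where
  "vec_lex cs = (\<chi> k. the (map_of (zip pairs_lex cs) (Rep_pair6 k)))"

definition Lambda :: "'v set \<Rightarrow> 'v set set \<Rightarrow> (nat \<Rightarrow> 'v) \<Rightarrow> (real ^ pair6) set" where
  "Lambda V E p =
     {l. (\<forall>k. 0 \<le> l $ k) \<and>
         (\<forall>e\<in>E. (\<Sum>k | separates V E e (p (fst (Rep_pair6 k))) (p (snd (Rep_pair6 k))). l $ k) = 1)}"

end

theory Submission
  imports Defs
begin

text \<open>Removing an edge of a tree disconnects two vertices exactly when the edge lies on the path
  between them, so the sum of a weight over the path joining \<open>p i\<close> and \<open>p j\<close> is the sum over all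
  edges that separate \<open>p i\<close> from \<open>p j\<close>. Every edge of the given tree either ends in one of the six
  leaves and cuts it off, or is one of the three interior edges with prescribed partition. Hence
  both \<open>Lambda\<close> and the set of generalized fillings depend only on nine explicit splits of
  \<open>{1..6}\<close> (\<open>six_leaf_tree_edges\<close>), and everything else takes place in coordinates.

  The nine equations force \<open>\<lambda>\<^sub>1\<^sub>2 = \<lambda>\<^sub>5\<^sub>6 = 1/2\<close> and
  \<open>\<lambda>\<^sub>1\<^sub>3 + \<lambda>\<^sub>2\<^sub>3 = \<lambda>\<^sub>4\<^sub>5 + \<lambda>\<^sub>4\<^sub>6 = 1/2\<close>; all coordinates are then determined by those joining
  \<open>{1, 2}\<close> to \<open>{5, 6}\<close>, those joining \<open>{1, 2}\<close> to \<open>4\<close>, and those joining \<open>3\<close> to \<open>{5, 6}\<close>, the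
  last two groups having equal sums. For a prescribed sum, the first group ranges over a
  tetrahedron, and the other two, being the margins of a \<open>2 \<times> 2\<close> transport problem, over a
  square. So the polytope is the join of a tetrahedron and a square: it has dimension
  \<open>3 + 2 + 1 = 6\<close> and is the hull of \<open>4 + 4\<close> points (\<open>split_polytope_eq_hull\<close>). Each of them is the
  only point of the polytope that vanishes where it vanishes, hence extreme
  (\<open>vertex_extreme\<close>); the only affine relation says that the diagonals of the square bisect each
  other (\<open>aff_dim_split_polytope\<close>).

  The formula for the weight is linear programming duality. Each vertex is half the indicator of
  a closed tour through the six leaves that traverses every edge of the tree exactly twice;
  adding the path inequalities along the tour bounds the weight of every filling from below
  (\<open>tour_value_le_weight\<close>). A filling attaining the largest of these bounds can be found among
  those with equality on the pairs 12, 13, 23, 45, 46, 56: they have three free edge weights, for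
  which the remaining inequalities are solved by hand (\<open>exists_optimal_weight\<close>).\<close>

section \<open>Paths, bridges and separation in trees\<close>

lemma reachable_sym: "(u, v) \<in> (adj F)\<^sup>* \<Longrightarrow> (v, u) \<in> (adj F)\<^sup>*"
proof -
  have "sym (adj F)"
    by (auto simp: sym_def adj_def insert_commute)
  then show "(u, v) \<in> (adj F)\<^sup>* \<Longrightarrow> (v, u) \<in> (adj F)\<^sup>*"
    by (meson sym_rtrancl symD)
qed

lemma successively_reachable:
  "xs \<noteq> [] \<Longrightarrow> successively (\<lambda>u v. {u, v} \<in> F) xs \<Longrightarrow> (hd xs, last xs) \<in> (adj F)\<^sup>*"
proof (induction xs rule: induct_list012)
  case (3 x y zs)
  then have "(x, y) \<in> adj F" "(y, last (y # zs)) \<in> (adj F)\<^sup>*"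
    by (auto simp: adj_def)
  then show ?case by simp
qed auto

lemma reachable_path:
  assumes "(u, v) \<in> (adj F)\<^sup>*" and "u \<in> V" and "\<And>e. e \<in> F \<Longrightarrow> e \<subseteq> V"
  obtains xs where "graph_path V F xs" "hd xs = u" "last xs = v"
proof -
  from assms(1) have "\<exists>xs. graph_path V F xs \<and> hd xs = u \<and> last xs = v"
  proof (induction rule: rtrancl_induct)
    case base
    then show ?case
      using assms(2) by (intro exI[of _ "[u]"]) (simp add: graph_path_def)
  next
    case (step y z)
    then obtain xs where xs: "graph_path V F xs" "hd xs = u" "last xs = y" by blast
    have yz: "{y, z} \<in> F" and z: "z \<in> V"
      using step.hyps(2) assms(3) by (auto simp: adj_def)
    show ?case
    proof (cases "z \<in> set xs")
      case True
      then obtain as bs where "xs = as @ z # bs" by (meson split_list)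
      then show ?thesis
        using xs
        by (intro exI[of _ "as @ [z]"])
          (auto simp: graph_path_def successively_append_iff hd_append)
    next
      case False
      then show ?thesis
        using xs yz z
        by (intro exI[of _ "xs @ [z]"])
          (auto simp: graph_path_def successively_append_iff)
    qed
  qed
  then show ?thesis using that by blast
qed

lemma graph_path_mono: "graph_path V F xs \<Longrightarrow> F \<subseteq> E \<Longrightarrow> graph_path V E xs"
  by (auto simp: graph_path_def elim!: successively_mono)

text \<open>A path avoiding the edge would close up with it to a cycle.\<close>

lemma tree_edge_bridge:
  assumes "tree V E" and "{u, v} \<in> E"
  shows "(u, v) \<notin> (adj (E - {{u, v}}))\<^sup>*"
proof
  let ?F = "E - {{u, v}}"
  assume "(u, v) \<in> (adj ?F)\<^sup>*"
  have E: "\<exists>a\<in>V. \<exists>b\<in>V. a \<noteq> b \<and> e = {a, b}" if "e \<in> E" for e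
    using assms(1) that by (auto simp: tree_def simple_graph_def)
  have uv: "u \<in> V" "u \<noteq> v"
    using E[OF assms(2)] by (auto simp: doubleton_eq_iff)
  have "e \<subseteq> V" if "e \<in> ?F" for e
    using E that by blast
  then obtain xs where xs: "graph_path V ?F xs" "hd xs = u" "last xs = v"
    using reachable_path[OF \<open>(u, v) \<in> (adj ?F)\<^sup>*\<close> uv(1)] by blast
  have "3 \<le> length xs"
  proof (rule ccontr)
    assume "\<not> 3 \<le> length xs"
    then have "length xs = 0 \<or> length xs = 1 \<or> length xs = 2" by linarith
    then have "xs = [] \<or> (\<exists>a. xs = [a]) \<or> (\<exists>a b. xs = [a, b])"
      by (auto simp: length_Suc_conv numeral_2_eq_2)
    then show False
      using xs uv by (auto simp: graph_path_def)
  qed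
  moreover have "graph_path V E xs"
    using xs(1) by (rule graph_path_mono) blast
  ultimately have "graph_cycle V E xs"
    using xs assms(2) by (simp add: graph_cycle_def insert_commute)
  then show False
    using assms(1) by (auto simp: tree_def)
qed

text \<open>If two paths with the same ends left their common start by different edges, the ends of
  the first of these edges would remain connected after its removal: follow one path to its
  end and the other one back.\<close>

lemma tree_path_unique:
  fixes xs ys :: "'v list"
  assumes "tree V E"
  shows "graph_path V E xs \<Longrightarrow> graph_path V E ys \<Longrightarrow> hd xs = hd ys \<Longrightarrow> last xs = last ys
    \<Longrightarrow> xs = ys"
proof (induction xs arbitrary: ys rule: induct_list012)
  case 1
  then show ?case by (simp add: graph_path_def)
next
  case (2 a)
  then obtain zs where "ys = a # zs"
    by (cases ys) (auto simp: graph_path_def)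
  with 2 show ?case
    by (cases zs rule: rev_cases) (auto simp: graph_path_def)
next
  case (3 a x xs)
  obtain y zs where ys: "ys = a # y # zs"
  proof -
    obtain ws where ws: "ys = a # ws"
      using "3.prems" by (cases ys) (auto simp: graph_path_def)
    moreover have "ws \<noteq> []"
      using "3.prems" ws by (auto simp: graph_path_def split: if_splits)
    ultimately show ?thesis
      using that by (cases ws) auto
  qed
  have "x = y"
  proof (rule ccontr)
    assume "x \<noteq> y"
    let ?F = "E - {{a, x}}"
    have avoid: "successively (\<lambda>u v. {u, v} \<in> ?F) ws"
      if "successively (\<lambda>u v. {u, v} \<in> E) ws" "a \<notin> set ws" for ws
      using that by (auto simp: doubleton_eq_iff elim!: successively_mono)
    have "(x, last (x # xs)) \<in> (adj ?F)\<^sup>*"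
      using successively_reachable[OF _ avoid, of "x # xs"] "3.prems"(1)
      by (simp add: graph_path_def)
    moreover have "(y, last (y # zs)) \<in> (adj ?F)\<^sup>*"
      using successively_reachable[OF _ avoid, of "y # zs"] "3.prems"(2) ys
      by (simp add: graph_path_def)
    moreover have "(a, y) \<in> adj ?F"
      using "3.prems"(2) ys \<open>x \<noteq> y\<close> by (auto simp: graph_path_def adj_def doubleton_eq_iff)
    moreover have "last (x # xs) = last (y # zs)"
      using "3.prems"(4) ys by simp
    ultimately have "(a, x) \<in> (adj ?F)\<^sup>*"
      by (metis converse_rtrancl_into_rtrancl reachable_sym rtrancl_trans)
    then show False
      using tree_edge_bridge[OF assms] "3.prems"(1) by (auto simp: graph_path_def)
  qed
  then have "x # xs = y # zs"
    using "3.prems" ys by (intro "3.IH"(2)) (auto simp: graph_path_def)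
  then show ?case using ys by simp
qed

text \<open>If a path through an edge existed together with a walk avoiding it, the latter would contain
  a second path with the same ends.\<close>

lemma tree_path_edges:
  assumes "tree V E" and "u \<in> V" and "v \<in> V"
  shows "path_edges V E u v = {e \<in> E. (u, v) \<notin> (adj (E - {e}))\<^sup>*}"
proof -
  have E: "e \<subseteq> V" if "e \<in> E" for e
    using assms(1) that by (auto simp: tree_def simple_graph_def)
  have uv: "(u, v) \<in> (adj E)\<^sup>*"
    using assms by (auto simp: tree_def connected_graph_def)
  obtain xs where xs: "graph_path V E xs" "hd xs = u" "last xs = v"
    using reachable_path[OF uv assms(2)] E by blast
  have uniq: "ys = xs" if "graph_path V E ys" "hd ys = u" "last ys = v" for ys
    using tree_path_unique[OF assms(1) that(1) xs(1)] that xs by simp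
  have "(THE xs. graph_path V E xs \<and> hd xs = u \<and> last xs = v) = xs"
    by (rule the_equality) (use xs uniq in blast)+
  then have "path_edges V E u v = {{xs ! i, xs ! Suc i} | i. Suc i < length xs}"
    by (simp only: path_edges_def Let_def)
  also have "\<dots> = {e \<in> E. (u, v) \<notin> (adj (E - {e}))\<^sup>*}"
  proof (intro equalityI subsetI)
    fix e assume "e \<in> {{xs ! i, xs ! Suc i} | i. Suc i < length xs}"
    then obtain i where i: "Suc i < length xs" "e = {xs ! i, xs ! Suc i}" by blast
    have "(u, v) \<notin> (adj (E - {e}))\<^sup>*"
    proof
      assume "(u, v) \<in> (adj (E - {e}))\<^sup>*"
      then obtain ys where ys: "graph_path V (E - {e}) ys" "hd ys = u" "last ys = v"
        using reachable_path[of u v "E - {e}" V] assms(2) E by blast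
      have "ys = xs"
        by (rule uniq[OF graph_path_mono[OF ys(1)] ys(2,3)]) blast
      then have "graph_path V (E - {e}) xs"
        using ys(1) by simp
      then show False
        using i by (auto simp: graph_path_def successively_conv_nth)
    qed
    moreover have "e \<in> E"
      using xs(1) i by (auto simp: graph_path_def successively_conv_nth)
    ultimately show "e \<in> {e \<in> E. (u, v) \<notin> (adj (E - {e}))\<^sup>*}" by simp
  next
    fix e assume e: "e \<in> {e \<in> E. (u, v) \<notin> (adj (E - {e}))\<^sup>*}"
    show "e \<in> {{xs ! i, xs ! Suc i} | i. Suc i < length xs}"
    proof (rule ccontr)
      assume "e \<notin> {{xs ! i, xs ! Suc i} | i. Suc i < length xs}"
      then have "{xs ! i, xs ! Suc i} \<noteq> e" if "Suc i < length xs" for i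
        using that by blast
      then have "successively (\<lambda>u v. {u, v} \<in> E - {e}) xs"
        using xs(1) by (simp add: graph_path_def successively_conv_nth)
      then show False
        using successively_reachable[of xs "E - {e}"] xs e by (auto simp: graph_path_def)
    qed
  qed
  finally show ?thesis .
qed

text \<open>Blocks of \<open>edge_partition\<close> are components cut down to the boundary. As \<open>u\<close> and \<open>v\<close> are
  boundary vertices, distinct components containing them remain distinct after the restriction.\<close>

lemma separates_iff_not_reachable:
  assumes "u \<in> boundary V E" and "v \<in> boundary V E"
  shows "separates V E e u v \<longleftrightarrow> (u, v) \<notin> (adj (E - {e}))\<^sup>*"
proof -
  let ?R = "(adj (E - {e}))\<^sup>*"
  have V: "u \<in> V" "v \<in> V"
    using assms by (auto simp: boundary_def)
  have block: "{w \<in> V. (x, w) \<in> ?R} = {w \<in> V. (y, w) \<in> ?R}" if "(x, y) \<in> ?R" for x y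
  proof -
    have "(x, w) \<in> ?R \<longleftrightarrow> (y, w) \<in> ?R" for w
      using that reachable_sym[OF that] by (meson rtrancl_trans)
    then show ?thesis by simp
  qed
  let ?B = "\<lambda>x. {w \<in> V. (x, w) \<in> ?R} \<inter> boundary V E"
  have "edge_partition V E e = ?B ` V"
    by (auto simp: edge_partition_def graph_components_def)
  then have "separates V E e u v \<longleftrightarrow> (\<exists>x\<in>V. \<exists>y\<in>V. ?B x \<noteq> ?B y \<and> u \<in> ?B x \<and> v \<in> ?B y)"
    by (simp add: separates_def)
  also have "\<dots> \<longleftrightarrow> ?B u \<noteq> ?B v"
  proof
    assume "?B u \<noteq> ?B v"
    then show "\<exists>x\<in>V. \<exists>y\<in>V. ?B x \<noteq> ?B y \<and> u \<in> ?B x \<and> v \<in> ?B y"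
      using V assms by (intro bexI[of _ u] bexI[of _ v]) auto
  next
    assume "\<exists>x\<in>V. \<exists>y\<in>V. ?B x \<noteq> ?B y \<and> u \<in> ?B x \<and> v \<in> ?B y"
    then obtain x y where "?B x \<noteq> ?B y" "(x, u) \<in> ?R" "(y, v) \<in> ?R" by blast
    then show "?B u \<noteq> ?B v"
      using block[of x u] block[of y v] by simp
  qed
  also have "\<dots> \<longleftrightarrow> (u, v) \<notin> ?R"
    using block[of u v] V assms by blast
  finally show ?thesis .
qed

text \<open>A pendant edge cuts off its leaf and nothing else: a walk between other vertices enters and
  leaves the leaf through the same neighbour, so the detour can be omitted.\<close>

lemma leaf_edge_reachable:
  assumes only: "\<And>f. f \<in> E \<Longrightarrow> x \<in> f \<Longrightarrow> f = {x, y}" and "u \<noteq> x" and "v \<noteq> x"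
    and "(u, v) \<in> (adj E)\<^sup>*"
  shows "(u, v) \<in> (adj (E - {{x, y}}))\<^sup>*"
proof -
  let ?R = "(adj (E - {{x, y}}))\<^sup>*"
  from assms(4) have "(u, if v = x then y else v) \<in> ?R"
  proof (induction rule: rtrancl_induct)
    case base
    then show ?case using assms(2) by simp
  next
    case (step w z)
    then have wz: "{w, z} \<in> E" by (simp add: adj_def)
    show ?case
    proof (cases "{w, z} = {x, y}")
      case True
      then show ?thesis
        using step.IH by (auto simp: doubleton_eq_iff split: if_splits)
    next
      case False
      then have "w \<noteq> x" "z \<noteq> x"
        using only[OF wz] by auto
      moreover from False wz have "(w, z) \<in> adj (E - {{x, y}})"
        by (simp add: adj_def)
      ultimately show ?thesis
        using step.IH by (auto intro: rtrancl_into_rtrancl)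
    qed
  qed
  then show ?thesis using assms(3) by simp
qed

lemma leaf_edge_isolates:
  assumes only: "\<And>f. f \<in> E \<Longrightarrow> x \<in> f \<Longrightarrow> f = e" and "(x, v) \<in> (adj (E - {e}))\<^sup>*"
  shows "v = x"
  using assms(2)
proof (induction rule: rtrancl_induct)
  case (step y z)
  then show ?case using only[of "{x, z}"] by (auto simp: adj_def)
qed simp

section \<open>The nine splits of the six leaves\<close>

text \<open>The leaves on the side of the \<open>k\<close>-th edge that does not contain leaf 6; edges 1 to 6 are the
  pendant ones. The normalization makes \<open>side\<close> injective on splits, and so distinct splits
  certify distinct edges.\<close>

definition side :: "nat \<Rightarrow> nat set" where
  "side k = [{1}, {2}, {3}, {4}, {5}, {1, 2, 3, 4, 5}, {1, 2}, {1, 2, 3}, {1, 2, 3, 4}] ! (k - 1)"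

lemma atLeastAtMost_1_6: "{1..6} = {1, 2, 3, 4, 5, 6 :: nat}"
  and atLeastAtMost_1_9: "{1..9} = {1, 2, 3, 4, 5, 6, 7, 8, 9 :: nat}"
  by auto

lemma side_simps:
  "side 1 = {1}" "side (Suc 0) = {1}" "side 2 = {2}" "side 3 = {3}" "side 4 = {4}" "side 5 = {5}"
  "side 6 = {1, 2, 3, 4, 5}" "side 7 = {1, 2}" "side 8 = {1, 2, 3}" "side 9 = {1, 2, 3, 4}"
  by (simp_all add: side_def)

lemma side_leaf:
  assumes "k \<in> {1..6}" and "i \<in> {1..6}"
  shows "i \<in> side k \<longleftrightarrow> (i = k) = (k \<noteq> 6)"
  using assms unfolding atLeastAtMost_1_6
  by (elim insertE emptyE; simp only: side_simps; simp)

lemma side_subset: "k \<in> {1..9} \<Longrightarrow> side k \<subseteq> {1..5}"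
  unfolding atLeastAtMost_1_9 by (auto simp: side_simps)

lemma inj_on_side: "inj_on side {1..9}"
proof -
  have "distinct (map side [1, 2, 3, 4, 5, 6, 7, 8, 9])"
    unfolding list.map side_simps by code_simp
  then show ?thesis
    unfolding atLeastAtMost_1_9 distinct_map by simp
qed

lemma separates_two_blocks:
  assumes "edge_partition V E e = {A, B}" and "u \<in> A \<longleftrightarrow> u \<notin> B" and "v \<in> A \<longleftrightarrow> v \<notin> B"
  shows "separates V E e u v \<longleftrightarrow> (u \<in> A) \<noteq> (v \<in> A)"
proof -
  have "A \<noteq> B"
    using assms(2) by blast
  then show ?thesis
    unfolding separates_def assms(1)
    by (cases "u \<in> A"; cases "v \<in> A") (use assms(2,3) in simp_all)
qed

lemma leaf_edge_separates:
  assumes "tree V E" and "boundary V E = p ` I" and "inj_on p I"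
    and "{f \<in> E. p k \<in> f} = {e}" and "k \<in> I" and "i \<in> I" and "j \<in> I"
  shows "separates V E e (p i) (p j) \<longleftrightarrow> (i = k) \<noteq> (j = k)"
proof -
  have only: "f = e" if "f \<in> E" "p k \<in> f" for f
    using that assms(4) by blast
  have "e \<in> E" "p k \<in> e"
    using assms(4) by auto
  then obtain y where y: "e = {p k, y}"
  proof -
    have "\<exists>a\<in>V. \<exists>b\<in>V. a \<noteq> b \<and> e = {a, b}"
      using assms(1) \<open>e \<in> E\<close> unfolding tree_def simple_graph_def by blast
    then obtain a b where "e = {a, b}" by blast
    with \<open>p k \<in> e\<close> show ?thesis
      using that[of a] that[of b] by (metis insertE insert_commute singletonD)
  qed
  have bd: "p x \<in> boundary V E" "p x \<in> V" "p x = p k \<longleftrightarrow> x = k" if "x \<in> I" for x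
    using that assms(2,3,5) by (auto simp: boundary_def inj_on_eq_iff)
  have iso: "(p k, p x) \<notin> (adj (E - {e}))\<^sup>*" if "x \<in> I" "x \<noteq> k" for x
    using leaf_edge_isolates[where v = "p x", OF only] bd(3)[OF that(1)] that(2) by metis
  have "(p i, p j) \<in> (adj (E - {e}))\<^sup>* \<longleftrightarrow> (i = k) = (j = k)"
  proof (cases "i = k \<or> j = k")
    case True
    then show ?thesis
      using iso[OF assms(6)] iso[OF assms(7)] reachable_sym[of "p i" "p j"] by blast
  next
    case False
    have "(p i, p j) \<in> (adj E)\<^sup>*"
      using assms(1,6,7) bd(2) by (simp add: tree_def connected_graph_def)
    moreover have "p i \<noteq> p k" "p j \<noteq> p k"
      using False bd(3)[OF assms(6)] bd(3)[OF assms(7)] by simp_all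
    ultimately have "(p i, p j) \<in> (adj (E - {{p k, y}}))\<^sup>*"
      using leaf_edge_reachable[OF only[unfolded y]] by blast
    then show ?thesis
      using False y by simp
  qed
  then show ?thesis
    unfolding separates_iff_not_reachable[OF bd(1)[OF assms(6)] bd(1)[OF assms(7)]] by simp
qed

text \<open>No edge is counted twice: membership of \<open>i\<close> in \<open>side k\<close> can be read off from the separation of
  \<open>p i\<close> and \<open>p 6\<close> by the \<open>k\<close>-th edge, so equal edges have equal sides.\<close>

lemma six_leaf_tree_edges:
  fixes p :: "nat \<Rightarrow> 'v"
  assumes p: "bij_betw p {1..6} M" and tree: "tree V E" and bd: "boundary V E = M"
    and int: "bij_betw (edge_partition V E) (interior_edges V E)
           {{{p 1, p 2}, {p 3, p 4, p 5, p 6}},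
            {{p 1, p 2, p 3}, {p 4, p 5, p 6}},
            {{p 1, p 2, p 3, p 4}, {p 5, p 6}}}"
  obtains e where "bij_betw e {1..9} E"
    and "\<And>k i j. k \<in> {1..9} \<Longrightarrow> i \<in> {1..6} \<Longrightarrow> j \<in> {1..6} \<Longrightarrow>
           separates V E (e k) (p i) (p j) \<longleftrightarrow> (i \<in> side k) \<noteq> (j \<in> side k)"
proof -
  have inj: "inj_on p {1..6}" and im: "boundary V E = p ` {1..6}"
    using p bd by (auto simp: bij_betw_def)
  have "\<exists>f. {f \<in> E. p k \<in> f} = {f}" if "k \<in> {1..6}" for k
  proof -
    have "p k \<in> boundary V E"
      using im that by simp
    then have "card {f \<in> E. p k \<in> f} = 1"
      by (simp add: boundary_def vertex_degree_def)
    then show ?thesis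
      by (simp add: card_1_singleton_iff)
  qed
  then have "\<exists>leaf. \<forall>k\<in>{1..6}. {f \<in> E. p k \<in> f} = {leaf k}"
    by (intro bchoice) blast
  then obtain leaf where leaf: "{f \<in> E. p k \<in> f} = {leaf k}" if "k \<in> {1..6}" for k
    by blast
  let ?block = "\<lambda>k. {p ` side k, p ` ({1..6} - side k)}"
  have blocks: "{{{p 1, p 2}, {p 3, p 4, p 5, p 6}},
            {{p 1, p 2, p 3}, {p 4, p 5, p 6}},
            {{p 1, p 2, p 3, p 4}, {p 5, p 6}}} = ?block ` {7, 8, 9}"
  proof -
    have "{1..6} - side 7 = {3, 4, 5, 6}" "{1..6} - side 8 = {4, 5, 6}" "{1..6} - side 9 = {5, 6}"
      by (auto simp: side_simps)
    then show ?thesis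
      by (simp add: side_simps)
  qed
  have parts_inj: "inj_on (edge_partition V E) (interior_edges V E)"
    and parts_im: "edge_partition V E ` interior_edges V E = ?block ` {7, 8, 9}"
    using int unfolding blocks bij_betw_def by (rule conjunct1, rule conjunct2)
  define mid where "mid k = inv_into (interior_edges V E) (edge_partition V E) (?block k)" for k
  have mid: "mid k \<in> interior_edges V E" "edge_partition V E (mid k) = ?block k"
    if "k \<in> {7, 8, 9}" for k
  proof -
    have "?block k \<in> edge_partition V E ` interior_edges V E"
      unfolding parts_im using that by (rule imageI)
    then show "mid k \<in> interior_edges V E" "edge_partition V E (mid k) = ?block k"
      unfolding mid_def by (rule inv_into_into, rule f_inv_into_f)
  qed
  define e where "e k = (if k \<le> 6 then leaf k else mid k)" for k
  have sep: "separates V E (e k) (p i) (p j) \<longleftrightarrow> (i \<in> side k) \<noteq> (j \<in> side k)"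
    if k: "k \<in> {1..9}" and ij: "i \<in> {1..6}" "j \<in> {1..6}" for k i j
  proof (cases "k \<le> 6")
    case True
    then have k6: "k \<in> {1..6}" using k by simp
    have "e k = leaf k"
      using True by (simp add: e_def)
    then have "separates V E (e k) (p i) (p j) \<longleftrightarrow> (i = k) \<noteq> (j = k)"
      using leaf_edge_separates[OF tree im inj leaf[OF k6] k6 ij] by (simp only:)
    also have "\<dots> \<longleftrightarrow> (i \<in> side k) \<noteq> (j \<in> side k)"
      unfolding side_leaf[OF k6 ij(1)] side_leaf[OF k6 ij(2)] by blast
    finally show ?thesis .
  next
    case False
    then have k789: "k \<in> {7, 8, 9}" using k by auto
    have "side k \<subseteq> {1..6}"
      using side_subset[OF k] by force
    then have mem: "p x \<in> p ` side k \<longleftrightarrow> x \<in> side k"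
      "p x \<in> p ` side k \<longleftrightarrow> p x \<notin> p ` ({1..6} - side k)" if "x \<in> {1..6}" for x
      using inj_on_image_mem_iff[OF inj that, of "side k"]
        inj_on_image_mem_iff[OF inj that, of "{1..6} - side k"] that by blast+
    have "e k = mid k"
      using False by (simp add: e_def)
    then show ?thesis
      using separates_two_blocks[OF mid(2)[OF k789] mem(2)[OF ij(1)] mem(2)[OF ij(2)]]
      by (simp only: mem(1)[OF ij(1)] mem(1)[OF ij(2)])
  qed
  have "inj_on e {1..9}"
  proof
    fix k l assume kl: "k \<in> {1..9}" "l \<in> {1..9}" "e k = e l"
    have "i \<in> side m \<longleftrightarrow> separates V E (e m) (p i) (p 6)" if "m \<in> {1..9}" "i \<in> {1..5}" for m i
    proof -
      have "6 \<notin> side m"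
        using side_subset[OF that(1)] by auto
      moreover have "i \<in> {1..6}"
        using that(2) by simp
      ultimately show ?thesis
        by (simp add: sep[OF that(1)])
    qed
    from this[OF kl(1)] this[OF kl(2)] have "i \<in> side k \<longleftrightarrow> i \<in> side l" if "i \<in> {1..5}" for i
      using that unfolding kl(3) by blast
    then have "side k = side l"
      using side_subset[OF kl(1)] side_subset[OF kl(2)] by blast
    then show "k = l"
      using inj_on_side kl by (simp add: inj_on_eq_iff)
  qed
  moreover have "e ` {1..9} = E"
  proof (intro equalityI subsetI)
    fix f assume "f \<in> e ` {1..9}"
    then obtain k where k: "k \<in> {1..9}" "f = e k" by blast
    show "f \<in> E"
    proof (cases "k \<le> 6")
      case True
      then show ?thesis using leaf[of k] k by (auto simp: e_def)
    next
      case False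
      then have "k \<in> {7, 8, 9}" using k by auto
      then show ?thesis using mid(1)[of k] k False by (simp add: e_def interior_edges_def)
    qed
  next
    fix f assume f: "f \<in> E"
    show "f \<in> e ` {1..9}"
    proof (cases "f \<in> interior_edges V E")
      case True
      then have "edge_partition V E f \<in> ?block ` {7, 8, 9}"
        unfolding parts_im[symmetric] by (rule imageI)
      then obtain k where k: "k \<in> {7, 8, 9}" "edge_partition V E f = ?block k"
        by (rule imageE)
      have "f = mid k"
        by (rule inj_onD[OF parts_inj _ True mid(1)[OF k(1)]]) (simp only: k(2) mid(2)[OF k(1)])
      then show ?thesis using k by (auto simp: e_def)
    next
      case False
      then obtain k where k: "k \<in> {1..6}" "p k \<in> f"
        using f unfolding interior_edges_def im by blast
      then have "f = leaf k" using leaf[of k] f by blast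
      then show ?thesis using k by (auto simp: e_def)
    qed
  qed
  ultimately have "bij_betw e {1..9} E"
    unfolding bij_betw_def by (rule conjI)
  then show ?thesis
    using sep by (rule that)
qed

definition path_sum :: "(nat \<Rightarrow> real) \<Rightarrow> nat \<Rightarrow> nat \<Rightarrow> real" where
  "path_sum w i j = (\<Sum>k\<in>{1..9}. if (i \<in> side k) \<noteq> (j \<in> side k) then w k else 0)"

lemma generalized_filling_iff_path_sums:
  fixes p :: "nat \<Rightarrow> 'v" and e :: "nat \<Rightarrow> 'v set"
  assumes tree: "tree V E" and bd: "p ` {1..6} \<subseteq> boundary V E" and e: "bij_betw e {1..9} E"
    and sep: "\<And>k i j. k \<in> {1..9} \<Longrightarrow> i \<in> {1..6} \<Longrightarrow> j \<in> {1..6} \<Longrightarrow>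
           separates V E (e k) (p i) (p j) \<longleftrightarrow> (i \<in> side k) \<noteq> (j \<in> side k)"
  shows "generalized_filling V E 6 p \<rho> \<omega> \<longleftrightarrow>
    (\<forall>(i, j)\<in>set pairs_lex. \<rho> (p i) (p j) \<le> path_sum (\<lambda>k. \<omega> (e k)) i j)"
proof -
  have "(\<Sum>f\<in>path_edges V E (p i) (p j). \<omega> f) = path_sum (\<lambda>k. \<omega> (e k)) i j"
    if less: "1 \<le> i \<and> i < j \<and> j \<le> 6" for i j
  proof -
    have ij: "i \<in> {1..6}" "j \<in> {1..6}"
      using less by auto
    have pb: "p i \<in> boundary V E" "p j \<in> boundary V E"
      using bd ij by auto
    then have "p i \<in> V" "p j \<in> V"
      by (auto simp: boundary_def)
    then have "path_edges V E (p i) (p j) = {f \<in> E. separates V E f (p i) (p j)}"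
      unfolding separates_iff_not_reachable[OF pb] by (rule tree_path_edges[OF tree])
    also have "\<dots> = {f \<in> e ` {1..9}. separates V E f (p i) (p j)}"
      using e by (simp add: bij_betw_def)
    also have "\<dots> = e ` {k \<in> {1..9}. (i \<in> side k) \<noteq> (j \<in> side k)}"
      using sep[OF _ ij] by blast
    finally have pe: "path_edges V E (p i) (p j)
        = e ` {k \<in> {1..9}. (i \<in> side k) \<noteq> (j \<in> side k)}" .
    have "inj_on e {k \<in> {1..9}. (i \<in> side k) \<noteq> (j \<in> side k)}"
      using bij_betw_imp_inj_on[OF e] by (rule inj_on_subset) blast
    then have "(\<Sum>f\<in>path_edges V E (p i) (p j). \<omega> f)
        = (\<Sum>k\<in>{k \<in> {1..9}. (i \<in> side k) \<noteq> (j \<in> side k)}. \<omega> (e k))"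
      unfolding pe by (simp only: sum.reindex o_def)
    then show ?thesis
      unfolding path_sum_def by (subst (asm) sum.inter_filter) simp_all
  qed
  then show ?thesis
    unfolding generalized_filling_def set_pairs_lex by simp
qed

section \<open>Coordinates on the space of pairs\<close>

definition coord :: "real ^ pair6 \<Rightarrow> nat \<Rightarrow> nat \<Rightarrow> real" where
  "coord x i j = x $ Abs_pair6 (i, j)"

lemma range_Rep_pair6: "range Rep_pair6 = set pairs_lex"
  unfolding set_pairs_lex by (rule type_definition.Rep_range[OF type_definition_pair6])

lemma Rep_Abs_pair6: "(i, j) \<in> set pairs_lex \<Longrightarrow> Rep_pair6 (Abs_pair6 (i, j)) = (i, j)"
  by (rule Abs_pair6_inverse) (simp add: set_pairs_lex)

lemma all_pair6: "(\<forall>k. P k) \<longleftrightarrow> (\<forall>(i, j)\<in>set pairs_lex. P (Abs_pair6 (i, j)))"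
proof
  assume P: "\<forall>(i, j)\<in>set pairs_lex. P (Abs_pair6 (i, j))"
  show "\<forall>k. P k"
  proof
    fix k
    obtain i j where ij: "Rep_pair6 k = (i, j)" by fastforce
    then have "(i, j) \<in> set pairs_lex"
      using range_Rep_pair6 by (metis rangeI)
    then have "P (Abs_pair6 (i, j))" using P by blast
    then show "P k" using ij Rep_pair6_inverse[of k] by simp
  qed
qed blast

lemma vec_eq_iff_coord: "x = y \<longleftrightarrow> (\<forall>(i, j)\<in>set pairs_lex. coord x i j = coord y i j)"
  unfolding vec_eq_iff coord_def by (rule all_pair6)

lemma sum_pair6:
  "(\<Sum>k | P (fst (Rep_pair6 k)) (snd (Rep_pair6 k)). x $ k)
     = (\<Sum>(i, j)\<leftarrow>pairs_lex. if P i j then coord x i j else 0)"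
proof -
  have "distinct pairs_lex"
    by (simp add: pairs_lex_def)
  then have "(\<Sum>(i, j)\<leftarrow>pairs_lex. if P i j then coord x i j else 0)
      = (\<Sum>(i, j)\<in>range Rep_pair6. if P i j then coord x i j else 0)"
    by (simp add: sum_list_distinct_conv_sum_set range_Rep_pair6)
  also have "\<dots> = (\<Sum>k\<in>UNIV. if P (fst (Rep_pair6 k)) (snd (Rep_pair6 k)) then x $ k else 0)"
    by (subst sum.reindex)
      (auto simp: inj_on_def Rep_pair6_inject case_prod_beta coord_def Rep_pair6_inverse
        intro!: sum.cong)
  finally show ?thesis
    by (simp add: sum.If_cases)
qed

lemma coord_linear [simp]:
  "coord (x + y) i j = coord x i j + coord y i j" "coord (x - y) i j = coord x i j - coord y i j"
  "coord (c *\<^sub>R x) i j = c * coord x i j" "coord 0 i j = 0"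
  by (simp_all add: coord_def)

lemma coord_sum [simp]: "coord (\<Sum>n\<in>A. f n) i j = (\<Sum>n\<in>A. coord (f n) i j)"
  by (simp add: coord_def)

lemma coord_vec_lex:
  assumes "length cs = 15"
  shows
  "coord (vec_lex cs) 1 2 = cs ! 0" "coord (vec_lex cs) 1 3 = cs ! 1" "coord (vec_lex cs) 1 4 = cs ! 2"
  "coord (vec_lex cs) 1 5 = cs ! 3" "coord (vec_lex cs) 1 6 = cs ! 4" "coord (vec_lex cs) 2 3 = cs ! 5"
  "coord (vec_lex cs) 2 4 = cs ! 6" "coord (vec_lex cs) 2 5 = cs ! 7" "coord (vec_lex cs) 2 6 = cs ! 8"
  "coord (vec_lex cs) 3 4 = cs ! 9" "coord (vec_lex cs) 3 5 = cs ! 10" "coord (vec_lex cs) 3 6 = cs ! 11"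
  "coord (vec_lex cs) 4 5 = cs ! 12" "coord (vec_lex cs) 4 6 = cs ! 13" "coord (vec_lex cs) 5 6 = cs ! 14"
proof -
  have "coord (vec_lex cs) (fst (pairs_lex ! m)) (snd (pairs_lex ! m)) = cs ! m" if "m < 15" for m
  proof -
    have len: "length pairs_lex = 15" and dist: "distinct pairs_lex"
      by (simp_all add: pairs_lex_def)
    then have "pairs_lex ! m \<in> set pairs_lex"
      using that by simp
    then have "coord (vec_lex cs) (fst (pairs_lex ! m)) (snd (pairs_lex ! m))
        = the (map_of (zip pairs_lex cs) (pairs_lex ! m))"
      using Rep_Abs_pair6[of "fst (pairs_lex ! m)" "snd (pairs_lex ! m)"]
      by (simp add: coord_def vec_lex_def)
    also have "\<dots> = cs ! m"
      using map_of_zip_nth[OF _ dist, of cs m] len assms that by simp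
    finally show ?thesis .
  qed
  note coords = this
  show
  "coord (vec_lex cs) 1 2 = cs ! 0" "coord (vec_lex cs) 1 3 = cs ! 1" "coord (vec_lex cs) 1 4 = cs ! 2"
  "coord (vec_lex cs) 1 5 = cs ! 3" "coord (vec_lex cs) 1 6 = cs ! 4" "coord (vec_lex cs) 2 3 = cs ! 5"
  "coord (vec_lex cs) 2 4 = cs ! 6" "coord (vec_lex cs) 2 5 = cs ! 7" "coord (vec_lex cs) 2 6 = cs ! 8"
  "coord (vec_lex cs) 3 4 = cs ! 9" "coord (vec_lex cs) 3 5 = cs ! 10" "coord (vec_lex cs) 3 6 = cs ! 11"
  "coord (vec_lex cs) 4 5 = cs ! 12" "coord (vec_lex cs) 4 6 = cs ! 13" "coord (vec_lex cs) 5 6 = cs ! 14"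
    using coords[of 0] coords[of 1] coords[of 2] coords[of 3] coords[of 4] coords[of 5] coords[of 6] 
      coords[of 7] coords[of 8] coords[of 9] coords[of 10] coords[of 11] coords[of 12] coords[of 13]
      coords[of 14] by (simp_all add: pairs_lex_def)
qed

section \<open>The polytope of the splits\<close>

definition cut_sum :: "real ^ pair6 \<Rightarrow> nat \<Rightarrow> real" where
  "cut_sum x k = (\<Sum>(i, j)\<leftarrow>pairs_lex. if (i \<in> side k) \<noteq> (j \<in> side k) then coord x i j else 0)"

definition split_polytope :: "(real ^ pair6) set" where
  "split_polytope = {x. (\<forall>k. 0 \<le> x $ k) \<and> (\<forall>k\<in>{1..9}. cut_sum x k = 1)}"

lemma Lambda_eq_split_polytope:
  fixes p :: "nat \<Rightarrow> 'v" and e :: "nat \<Rightarrow> 'v set"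
  assumes e: "bij_betw e {1..9} E"
    and sep: "\<And>k i j. k \<in> {1..9} \<Longrightarrow> i \<in> {1..6} \<Longrightarrow> j \<in> {1..6} \<Longrightarrow>
           separates V E (e k) (p i) (p j) \<longleftrightarrow> (i \<in> side k) \<noteq> (j \<in> side k)"
  shows "Lambda V E p = split_polytope"
proof -
  have "(\<Sum>k | separates V E (e m) (p (fst (Rep_pair6 k))) (p (snd (Rep_pair6 k))). x $ k)
      = cut_sum x m"
    if "m \<in> {1..9}" for m x
  proof -
    have "separates V E (e m) (p (fst q)) (p (snd q))
        \<longleftrightarrow> (fst q \<in> side m) \<noteq> (snd q \<in> side m)" if "q \<in> set pairs_lex" for q
      by (rule sep) (use that \<open>m \<in> {1..9}\<close> in \<open>auto simp: set_pairs_lex\<close>)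
    then show ?thesis
      unfolding cut_sum_def sum_pair6[where P = "\<lambda>i j. separates V E (e m) (p i) (p j)"]
      by (intro arg_cong[of _ _ sum_list] map_cong) (auto simp: case_prod_beta)
  qed
  moreover have "E = e ` {1..9}"
    using e by (simp add: bij_betw_def)
  ultimately show ?thesis
    unfolding Lambda_def split_polytope_def by (simp only: ball_simps cong: ball_cong)
qed

lemma cut_sum_simps:
  "cut_sum x 1 = coord x 1 2 + coord x 1 3 + coord x 1 4 + coord x 1 5 + coord x 1 6"
  "cut_sum x 2 = coord x 1 2 + coord x 2 3 + coord x 2 4 + coord x 2 5 + coord x 2 6"
  "cut_sum x 3 = coord x 1 3 + coord x 2 3 + coord x 3 4 + coord x 3 5 + coord x 3 6"
  "cut_sum x 4 = coord x 1 4 + coord x 2 4 + coord x 3 4 + coord x 4 5 + coord x 4 6"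
  "cut_sum x 5 = coord x 1 5 + coord x 2 5 + coord x 3 5 + coord x 4 5 + coord x 5 6"
  "cut_sum x 6 = coord x 1 6 + coord x 2 6 + coord x 3 6 + coord x 4 6 + coord x 5 6"
  "cut_sum x 7 = coord x 1 3 + coord x 1 4 + coord x 1 5 + coord x 1 6 + coord x 2 3 + coord x 2 4 + coord x 2 5 + coord x 2 6"
  "cut_sum x 8 = coord x 1 4 + coord x 1 5 + coord x 1 6 + coord x 2 4 + coord x 2 5 + coord x 2 6 + coord x 3 4 + coord x 3 5 + coord x 3 6"
  "cut_sum x 9 = coord x 1 5 + coord x 1 6 + coord x 2 5 + coord x 2 6 + coord x 3 5 + coord x 3 6 + coord x 4 5 + coord x 4 6"
  by (simp_all add: cut_sum_def side_simps pairs_lex_def del: One_nat_def)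

text \<open>The equations of edges 1 and 2 together count the pair 12 twice, that of edge 7 omits it, and
  on all other pairs they agree; so \<open>\<lambda>\<^sub>1\<^sub>2 = 1/2\<close>. The same comparison works for edges 5, 6 with
  edge 9, and for edges 1, 2, 3 as well as 4, 5, 6 with edge 8.\<close>

lemma mem_split_polytope:
  "x \<in> split_polytope \<longleftrightarrow> (\<forall>(i, j)\<in>set pairs_lex. 0 \<le> coord x i j)
    \<and> coord x 1 2 = 1/2 \<and> coord x 5 6 = 1/2
    \<and> coord x 1 3 + coord x 2 3 = 1/2 \<and> coord x 4 5 + coord x 4 6 = 1/2
    \<and> coord x 1 3 + coord x 1 4 + coord x 1 5 + coord x 1 6 = 1/2
    \<and> coord x 2 3 + coord x 2 4 + coord x 2 5 + coord x 2 6 = 1/2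
    \<and> coord x 3 4 + coord x 3 5 + coord x 3 6 = 1/2
    \<and> coord x 1 4 + coord x 2 4 + coord x 3 4 = 1/2
    \<and> coord x 1 5 + coord x 2 5 + coord x 3 5 + coord x 4 5 = 1/2"
proof -
  have "(\<forall>k. 0 \<le> x $ k) \<longleftrightarrow> (\<forall>(i, j)\<in>set pairs_lex. 0 \<le> coord x i j)"
    unfolding coord_def by (rule all_pair6)
  moreover have "(\<forall>k\<in>{1..9}. cut_sum x k = 1) \<longleftrightarrow> cut_sum x 1 = 1 \<and> cut_sum x 2 = 1 \<and> cut_sum x 3 = 1
      \<and> cut_sum x 4 = 1 \<and> cut_sum x 5 = 1 \<and> cut_sum x 6 = 1 \<and> cut_sum x 7 = 1 \<and> cut_sum x 8 = 1
      \<and> cut_sum x 9 = 1"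
    unfolding atLeastAtMost_1_9 by blast
  ultimately show ?thesis
    unfolding split_polytope_def mem_Collect_eq cut_sum_simps
    by (simp only:) (intro conj_cong refl iffI; elim conjE; intro conjI; linarith)
qed

text \<open>Twice the vertex is the indicator of the edges of a tour: 1-2-3-4-5-6-1 for the first one.
  Numbers 0, 1, 4, 5 use the pair 34 and one pair between \<open>{1, 2}\<close> and \<open>{5, 6}\<close>; they span the
  tetrahedron. Numbers 2, 3, 6, 7 use one pair between \<open>{1, 2}\<close> and 4 and one between 3 and
  \<open>{5, 6}\<close>; they span the square.\<close>

definition vertex :: "nat \<Rightarrow> real ^ pair6" where
  "vertex n = (1/2) *\<^sub>R vec_lex
     ([[1,0,0,0,1,1,0,0,0,1,0,0,1,0,1],
       [1,1,0,0,0,0,0,0,1,1,0,0,1,0,1],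
       [1,0,1,0,0,1,0,0,0,0,0,1,1,0,1],
       [1,1,0,0,0,0,1,0,0,0,0,1,1,0,1],
       [1,0,0,1,0,1,0,0,0,1,0,0,0,1,1],
       [1,1,0,0,0,0,0,1,0,1,0,0,0,1,1],
       [1,0,1,0,0,1,0,0,0,0,1,0,0,1,1],
       [1,1,0,0,0,0,1,0,0,0,1,0,0,1,1]] ! n)"

lemma vertex_simps:
  "vertex 0 = (1/2) *\<^sub>R vec_lex [1,0,0,0,1,1,0,0,0,1,0,0,1,0,1]"
  "vertex 1 = (1/2) *\<^sub>R vec_lex [1,1,0,0,0,0,0,0,1,1,0,0,1,0,1]"
  "vertex 2 = (1/2) *\<^sub>R vec_lex [1,0,1,0,0,1,0,0,0,0,0,1,1,0,1]"
  "vertex 3 = (1/2) *\<^sub>R vec_lex [1,1,0,0,0,0,1,0,0,0,0,1,1,0,1]"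
  "vertex 4 = (1/2) *\<^sub>R vec_lex [1,0,0,1,0,1,0,0,0,1,0,0,0,1,1]"
  "vertex 5 = (1/2) *\<^sub>R vec_lex [1,1,0,0,0,0,0,1,0,1,0,0,0,1,1]"
  "vertex 6 = (1/2) *\<^sub>R vec_lex [1,0,1,0,0,1,0,0,0,0,1,0,0,1,1]"
  "vertex 7 = (1/2) *\<^sub>R vec_lex [1,1,0,0,0,0,1,0,0,0,1,0,0,1,1]"
  by (simp_all add: vertex_def)

lemma lessThan_8: "{..<8} = {0, 1, 2, 3, 4, 5, 6, 7 :: nat}"
  by auto

lemma vertex_in_split_polytope: "n < 8 \<Longrightarrow> vertex n \<in> split_polytope"
proof -
  assume "n < 8"
  then have "n \<in> {0, 1, 2, 3, 4, 5, 6, 7}" by auto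
  then show ?thesis
    by (elim insertE emptyE)
      (simp_all add: mem_split_polytope vertex_simps coord_vec_lex pairs_lex_def del: One_nat_def)
qed

lemma transport_2x2:
  fixes a b c d :: real
  assumes "0 \<le> a" "0 \<le> b" "0 \<le> c" "0 \<le> d" "a + b = c + d"
  obtains q r s t where "0 \<le> q" "0 \<le> r" "0 \<le> s" "0 \<le> t"
    "q + r = a" "s + t = b" "q + s = c" "r + t = d"
proof
  show "0 \<le> min a c" "0 \<le> a - min a c" "0 \<le> c - min a c" "0 \<le> b - (c - min a c)"
    "min a c + (a - min a c) = a" "(c - min a c) + (b - (c - min a c)) = b"
    "min a c + (c - min a c) = c" "(a - min a c) + (b - (c - min a c)) = d"
    using assms by auto
qed

lemma split_polytope_nonneg: "x \<in> split_polytope \<Longrightarrow> (i, j) \<in> set pairs_lex \<Longrightarrow> 0 \<le> coord x i j"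
  by (simp add: split_polytope_def coord_def)

lemma split_polytope_equations:
  assumes "x \<in> split_polytope"
  shows "coord x 1 2 = 1/2" "coord x 5 6 = 1/2"
    "coord x 1 3 + coord x 2 3 = 1/2" "coord x 4 5 + coord x 4 6 = 1/2"
    "coord x 1 3 + coord x 1 4 + coord x 1 5 + coord x 1 6 = 1/2"
    "coord x 2 3 + coord x 2 4 + coord x 2 5 + coord x 2 6 = 1/2"
    "coord x 3 4 + coord x 3 5 + coord x 3 6 = 1/2"
    "coord x 1 4 + coord x 2 4 + coord x 3 4 = 1/2"
    "coord x 1 5 + coord x 2 5 + coord x 3 5 + coord x 4 5 = 1/2"
  using assms unfolding mem_split_polytope by blast+

lemma split_polytope_subset_hull: "split_polytope \<subseteq> convex hull (vertex ` {..<8})"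
proof
  fix x assume "x \<in> split_polytope"
  note eqs = split_polytope_equations[OF this] and pos = split_polytope_nonneg[OF this]
  have nonneg: "0 \<le> coord x 1 4" "0 \<le> coord x 2 4" "0 \<le> coord x 3 5" "0 \<le> coord x 3 6"
    "0 \<le> coord x 1 5" "0 \<le> coord x 1 6" "0 \<le> coord x 2 5" "0 \<le> coord x 2 6"
    by (auto intro!: pos simp: set_pairs_lex)
  obtain q r s t where q: "0 \<le> q" "0 \<le> r" "0 \<le> s" "0 \<le> t"
    "q + r = 2 * coord x 1 4" "s + t = 2 * coord x 2 4"
    "q + s = 2 * coord x 3 5" "r + t = 2 * coord x 3 6"
  proof (rule transport_2x2)
    show "0 \<le> 2 * coord x 1 4" "0 \<le> 2 * coord x 2 4" "0 \<le> 2 * coord x 3 5" "0 \<le> 2 * coord x 3 6"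
      using nonneg by linarith+
    show "2 * coord x 1 4 + 2 * coord x 2 4 = 2 * coord x 3 5 + 2 * coord x 3 6"
      using eqs(7,8) by linarith
  qed
  \<comment> \<open>A tetrahedral vertex is the only one with a nonzero entry at its pair between \<open>{1, 2}\<close> and
    \<open>{5, 6}\<close>, so its coefficient is forced; on the square, any transport plan will do.\<close>
  define c where "c n =
      [2 * coord x 1 6, 2 * coord x 2 6, r, t, 2 * coord x 1 5, 2 * coord x 2 5, q, s] ! n"
    for n :: nat
  have c: "(\<Sum>n<8. c n) = 1" "\<forall>n\<in>{..<8}. 0 \<le> c n"
  proof -
    have "2 * coord x 1 6 + 2 * coord x 2 6 + r + t + 2 * coord x 1 5 + 2 * coord x 2 5 + q + s = 1"
      using eqs(3,5,6,7,8) q(5-) by linarith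
    then show "(\<Sum>n<8. c n) = 1"
      by (simp add: lessThan_8 c_def add.assoc del: One_nat_def)
    show "\<forall>n\<in>{..<8}. 0 \<le> c n"
      using q(1-4) nonneg by (simp add: lessThan_8 c_def del: One_nat_def)
  qed
  have "x = (\<Sum>n<8. c n *\<^sub>R vertex n)"
    unfolding vec_eq_iff_coord
    by (simp add: lessThan_8 c_def pairs_lex_def vertex_simps coord_vec_lex del: One_nat_def)
      (insert eqs q(5-), intro conjI; linarith)
  also have "\<dots> \<in> convex hull (vertex ` {..<8})"
    by (rule convex_sum) (use c in \<open>auto intro: hull_inc\<close>)
  finally show "x \<in> convex hull (vertex ` {..<8})" .
qed


lemma convex_split_polytope: "convex split_polytope"
proof -
  have lin: "cut_sum (u *\<^sub>R x + v *\<^sub>R y) k = u * cut_sum x k + v * cut_sum y k" for u v x y k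
  proof -
    have "(\<Sum>(i, j)\<leftarrow>ps. if (i \<in> side k) \<noteq> (j \<in> side k) then coord (u *\<^sub>R x + v *\<^sub>R y) i j else 0)
        = u * (\<Sum>(i, j)\<leftarrow>ps. if (i \<in> side k) \<noteq> (j \<in> side k) then coord x i j else 0)
        + v * (\<Sum>(i, j)\<leftarrow>ps. if (i \<in> side k) \<noteq> (j \<in> side k) then coord y i j else 0)" for ps
      by (induction ps) (auto simp: algebra_simps)
    then show ?thesis
      by (simp only: cut_sum_def)
  qed
  show ?thesis
    unfolding split_polytope_def convex_def by (auto simp: lin)
qed

lemma split_polytope_eq_hull: "split_polytope = convex hull (vertex ` {..<8})"
  using split_polytope_subset_hull vertex_in_split_polytope
  by (intro equalityI hull_minimal convex_split_polytope) auto

text \<open>In a set of nonnegative vectors, both ends of a segment vanish wherever one of its inner points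
  does.\<close>

lemma extreme_point_of_zero_pattern:
  fixes v :: "real ^ 'n"
  assumes nonneg: "\<And>x k. x \<in> S \<Longrightarrow> 0 \<le> x $ k" and "v \<in> S"
    and uniq: "\<And>x. x \<in> S \<Longrightarrow> (\<And>k. v $ k = 0 \<Longrightarrow> x $ k = 0) \<Longrightarrow> x = v"
  shows "v extreme_point_of S"
  unfolding extreme_point_of_def
proof (intro conjI ballI notI)
  fix a b assume ab: "a \<in> S" "b \<in> S" "v \<in> open_segment a b"
  then obtain u where u: "a \<noteq> b" "0 < u" "u < 1" "v = (1 - u) *\<^sub>R a + u *\<^sub>R b"
    by (auto simp: in_segment)
  have "a $ k = 0 \<and> b $ k = 0" if "v $ k = 0" for k
  proof -
    have "(1 - u) * a $ k + u * b $ k = 0"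
      using that u(4) by simp
    moreover have "0 \<le> (1 - u) * a $ k" "0 \<le> u * b $ k"
      using u(2,3) nonneg ab by simp_all
    ultimately have "(1 - u) * a $ k = 0 \<and> u * b $ k = 0"
      by linarith
    then show ?thesis
      using u(2,3) by simp
  qed
  then have "a = v" "b = v"
    using uniq ab by blast+
  then show False
    using u(1) by simp
qed (fact assms(2))

lemma vertex_extreme:
  assumes "n < 8"
  shows "vertex n extreme_point_of split_polytope"
proof (rule extreme_point_of_zero_pattern)
  show "vertex n \<in> split_polytope"
    using assms by (rule vertex_in_split_polytope)
  show "0 \<le> x $ k" if "x \<in> split_polytope" for x k
    using that by (simp add: split_polytope_def)
  fix x assume x: "x \<in> split_polytope" and z: "\<And>k. vertex n $ k = 0 \<Longrightarrow> x $ k = 0"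
  have z: "\<forall>(i, j)\<in>set pairs_lex. coord (vertex n) i j = 0 \<longrightarrow> coord x i j = 0"
    using z by (auto simp: coord_def)
  have "n \<in> {0, 1, 2, 3, 4, 5, 6, 7}" using assms by auto
  then show "x = vertex n"
    unfolding vec_eq_iff_coord using z
    by (elim insertE emptyE; simp add: vertex_simps coord_vec_lex pairs_lex_def del: One_nat_def;
        insert split_polytope_equations[OF x]; elim conjE; intro conjI; linarith)
qed

lemma extreme_points_split_polytope:
  "{x. x extreme_point_of split_polytope} = vertex ` {..<8}"
  using vertex_extreme extreme_points_of_convex_hull[of "vertex ` {..<8}"]
  by (auto simp: split_polytope_eq_hull)

lemma inj_on_vertex: "inj_on vertex {..<8}"
proof (rule inj_on_inverseI)
  fix n :: nat assume "n \<in> {..<8}"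
  \<comment> \<open>The weights spell out the number of the vertex: each tetrahedral vertex is recognized by its pair
    between \<open>{1, 2}\<close> and \<open>{5, 6}\<close>, and on the square \<open>n\<close> is 2 or 6 (according to the pair 36 or 35)
    plus 1 if the pair 24 is used.\<close>
  then show "nat \<lfloor>2 * (coord (vertex n) 2 6 + 4 * coord (vertex n) 1 5 + 5 * coord (vertex n) 2 5
      + coord (vertex n) 2 4 + 2 * coord (vertex n) 3 6 + 6 * coord (vertex n) 3 5)\<rfloor> = n"
    unfolding lessThan_8
    by (elim insertE emptyE) (simp_all add: vertex_simps coord_vec_lex del: One_nat_def)
qed

text \<open>Dropping one corner of the square leaves seven affinely independent points: apart from number 7,
  each has a coordinate at which the other six vanish.\<close>

lemma aff_dim_split_polytope: "aff_dim split_polytope = 6"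
proof -
  define J where "J = {0, 1, 3, 4, 5, 6, 7 :: nat}"
  have sub: "J \<subseteq> {..<8}" and fin: "finite J" and card: "card J = 7"
    by (auto simp: J_def)
  have inj: "inj_on vertex J"
    by (rule inj_on_subset[OF inj_on_vertex sub])
  have square: "vertex 2 = vertex 3 + vertex 6 - vertex 7"
    unfolding vec_eq_iff_coord
    by (simp add: vertex_simps coord_vec_lex pairs_lex_def del: One_nat_def)
  have "vertex 2 \<in> affine hull {vertex 3, vertex 6, vertex 7}"
    unfolding affine_hull_3 mem_Collect_eq
    by (rule exI[of _ 1], rule exI[of _ 1], rule exI[of _ "-1"]) (simp add: square)
  then have "vertex 2 \<in> affine hull (vertex ` J)"
    by (rule subsetD[OF hull_mono, rotated]) (simp add: J_def)
  moreover have "vertex ` {..<8} = insert (vertex 2) (vertex ` J)"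
  proof -
    have "{..<8} = insert 2 J"
      by (auto simp: J_def)
    then show ?thesis
      by (simp only: image_insert)
  qed
  ultimately have "aff_dim (vertex ` {..<8}) = aff_dim (vertex ` J)"
    by (simp only: aff_dim_insert if_True)
  moreover have "\<not> affine_dependent (vertex ` J)"
  proof
    assume "affine_dependent (vertex ` J)"
    then have "\<exists>U. sum U (vertex ` J) = 0 \<and> (\<exists>v\<in>vertex ` J. U v \<noteq> 0) \<and>
        (\<Sum>v\<in>vertex ` J. U v *\<^sub>R v) = 0"
      by (simp only: affine_dependent_explicit_finite[OF finite_imageI[OF fin]])
    then obtain U where U: "sum U (vertex ` J) = 0" "\<exists>v\<in>vertex ` J. U v \<noteq> 0"
        "(\<Sum>v\<in>vertex ` J. U v *\<^sub>R v) = 0"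
      by (elim exE conjE)
    define w where "w n = U (vertex n)" for n
    have zero: "(\<Sum>n\<in>J. w n) = 0"
      using U(1) unfolding w_def by (simp only: sum.reindex[OF inj] o_def)
    have "(\<Sum>n\<in>J. w n *\<^sub>R vertex n) = 0"
      using U(3) unfolding w_def by (simp only: sum.reindex[OF inj] o_def)
    then have "coord (\<Sum>n\<in>J. w n *\<^sub>R vertex n) i j = 0" for i j
      by (simp only: coord_linear)
    then have coords: "(\<Sum>n\<in>J. w n * coord (vertex n) i j) = 0" for i j
      by (simp only: coord_sum coord_linear)
    have "w 6 = 0"
      using coords[of 1 4] by (simp add: J_def vertex_simps coord_vec_lex del: One_nat_def)
    moreover have "w 4 = 0"
      using coords[of 1 5] by (simp add: J_def vertex_simps coord_vec_lex del: One_nat_def)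
    moreover have "w 0 = 0"
      using coords[of 1 6] by (simp add: J_def vertex_simps coord_vec_lex del: One_nat_def)
    moreover have "w 5 = 0"
      using coords[of 2 5] by (simp add: J_def vertex_simps coord_vec_lex del: One_nat_def)
    moreover have "w 1 = 0"
      using coords[of 2 6] by (simp add: J_def vertex_simps coord_vec_lex del: One_nat_def)
    moreover have "w 3 = 0"
      using coords[of 3 6] by (simp add: J_def vertex_simps coord_vec_lex del: One_nat_def)
    ultimately have "\<forall>n\<in>J. w n = 0"
      using zero by (simp add: J_def)
    then show False
      using U(2) unfolding w_def by blast
  qed
  then have "int (card (vertex ` J)) = aff_dim (vertex ` J) + 1"
    by (rule aff_dim_affine_independent)
  moreover have "card (vertex ` J) = 7"
    using card by (simp only: card_image[OF inj])
  ultimately show ?thesis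
    by (simp add: split_polytope_eq_hull aff_dim_convex_hull)
qed

section \<open>The weight of a minimal filling\<close>

lemma path_sum_simps:
  "path_sum w 1 2 = w 1 + w 2" "path_sum w 1 3 = w 1 + w 3 + w 7" "path_sum w 1 4 = w 1 + w 4 + w 7 + w 8"
  "path_sum w 1 5 = w 1 + w 5 + w 7 + w 8 + w 9" "path_sum w 1 6 = w 1 + w 6 + w 7 + w 8 + w 9" "path_sum w 2 3 = w 2 + w 3 + w 7"
  "path_sum w 2 4 = w 2 + w 4 + w 7 + w 8" "path_sum w 2 5 = w 2 + w 5 + w 7 + w 8 + w 9" "path_sum w 2 6 = w 2 + w 6 + w 7 + w 8 + w 9"
  "path_sum w 3 4 = w 3 + w 4 + w 8" "path_sum w 3 5 = w 3 + w 5 + w 8 + w 9" "path_sum w 3 6 = w 3 + w 6 + w 8 + w 9"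
  "path_sum w 4 5 = w 4 + w 5 + w 9" "path_sum w 4 6 = w 4 + w 6 + w 9" "path_sum w 5 6 = w 5 + w 6"
  unfolding path_sum_def atLeastAtMost_1_9 by (simp_all add: side_simps del: One_nat_def)

definition tour_values :: "(nat \<Rightarrow> nat \<Rightarrow> real) \<Rightarrow> real set" where
  "tour_values d =
    {(1/2) * (d 1 2 + d 1 6 + d 2 3 + d 3 4 + d 4 5 + d 5 6),
     (1/2) * (d 1 2 + d 1 3 + d 2 6 + d 3 4 + d 4 5 + d 5 6),
     (1/2) * (d 1 2 + d 1 4 + d 2 3 + d 3 6 + d 4 5 + d 5 6),
     (1/2) * (d 1 2 + d 1 3 + d 2 4 + d 3 6 + d 4 5 + d 5 6),
     (1/2) * (d 1 2 + d 1 5 + d 2 3 + d 3 4 + d 4 6 + d 5 6),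
     (1/2) * (d 1 2 + d 1 3 + d 2 5 + d 3 4 + d 4 6 + d 5 6),
     (1/2) * (d 1 2 + d 1 4 + d 2 3 + d 3 5 + d 4 6 + d 5 6),
     (1/2) * (d 1 2 + d 1 3 + d 2 4 + d 3 5 + d 4 6 + d 5 6)}"

text \<open>Along a tour, every edge of the tree is traversed exactly twice.\<close>

lemma tour_value_le_weight:
  assumes "v \<in> tour_values d"
    and "\<And>i j. (i, j) \<in> set pairs_lex \<Longrightarrow> d i j \<le> path_sum w i j"
  shows "v \<le> (\<Sum>k\<in>{1..9}. w k)"
proof -
  have total: "(\<Sum>k\<in>{1..9}. w k) = w 1 + w 2 + w 3 + w 4 + w 5 + w 6 + w 7 + w 8 + w 9"
    unfolding atLeastAtMost_1_9 by (simp del: One_nat_def)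
  have filling:
    "d 1 2 \<le> path_sum w 1 2" "d 1 3 \<le> path_sum w 1 3" "d 1 4 \<le> path_sum w 1 4"
    "d 1 5 \<le> path_sum w 1 5" "d 1 6 \<le> path_sum w 1 6" "d 2 3 \<le> path_sum w 2 3"
    "d 2 4 \<le> path_sum w 2 4" "d 2 5 \<le> path_sum w 2 5" "d 2 6 \<le> path_sum w 2 6"
    "d 3 4 \<le> path_sum w 3 4" "d 3 5 \<le> path_sum w 3 5" "d 3 6 \<le> path_sum w 3 6"
    "d 4 5 \<le> path_sum w 4 5" "d 4 6 \<le> path_sum w 4 6" "d 5 6 \<le> path_sum w 5 6"
    by (rule assms(2), simp add: pairs_lex_def)+
  have double:
    "path_sum w 1 2 + path_sum w 1 6 + path_sum w 2 3 + path_sum w 3 4 + path_sum w 4 5 + path_sum w 5 6 = 2 * (\<Sum>k\<in>{1..9}. w k)"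
    "path_sum w 1 2 + path_sum w 1 3 + path_sum w 2 6 + path_sum w 3 4 + path_sum w 4 5 + path_sum w 5 6 = 2 * (\<Sum>k\<in>{1..9}. w k)"
    "path_sum w 1 2 + path_sum w 1 4 + path_sum w 2 3 + path_sum w 3 6 + path_sum w 4 5 + path_sum w 5 6 = 2 * (\<Sum>k\<in>{1..9}. w k)"
    "path_sum w 1 2 + path_sum w 1 3 + path_sum w 2 4 + path_sum w 3 6 + path_sum w 4 5 + path_sum w 5 6 = 2 * (\<Sum>k\<in>{1..9}. w k)"
    "path_sum w 1 2 + path_sum w 1 5 + path_sum w 2 3 + path_sum w 3 4 + path_sum w 4 6 + path_sum w 5 6 = 2 * (\<Sum>k\<in>{1..9}. w k)"
    "path_sum w 1 2 + path_sum w 1 3 + path_sum w 2 5 + path_sum w 3 4 + path_sum w 4 6 + path_sum w 5 6 = 2 * (\<Sum>k\<in>{1..9}. w k)"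
    "path_sum w 1 2 + path_sum w 1 4 + path_sum w 2 3 + path_sum w 3 5 + path_sum w 4 6 + path_sum w 5 6 = 2 * (\<Sum>k\<in>{1..9}. w k)"
    "path_sum w 1 2 + path_sum w 1 3 + path_sum w 2 4 + path_sum w 3 5 + path_sum w 4 6 + path_sum w 5 6 = 2 * (\<Sum>k\<in>{1..9}. w k)"
    unfolding path_sum_simps total by simp_all
  have "2 * v \<in>
    {d 1 2 + d 1 6 + d 2 3 + d 3 4 + d 4 5 + d 5 6,
     d 1 2 + d 1 3 + d 2 6 + d 3 4 + d 4 5 + d 5 6,
     d 1 2 + d 1 4 + d 2 3 + d 3 6 + d 4 5 + d 5 6,
     d 1 2 + d 1 3 + d 2 4 + d 3 6 + d 4 5 + d 5 6,
     d 1 2 + d 1 5 + d 2 3 + d 3 4 + d 4 6 + d 5 6,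
     d 1 2 + d 1 3 + d 2 5 + d 3 4 + d 4 6 + d 5 6,
     d 1 2 + d 1 4 + d 2 3 + d 3 5 + d 4 6 + d 5 6,
     d 1 2 + d 1 3 + d 2 4 + d 3 5 + d 4 6 + d 5 6}"
    using assms(1) by (auto simp: tour_values_def simp del: One_nat_def)
  then show ?thesis
    by (elim insertE emptyE; insert filling double; linarith)
qed

text \<open>Equality on the pairs 12, 13, 23 and 45, 46, 56 determines the weights \<open>x1\<close>, \<open>x2\<close>, \<open>x5\<close>, \<open>x6\<close> of
  pendant edges and the sums \<open>K\<close> and \<open>L\<close> of the weights of the edges at leaf 3 and at leaf 4 with
  those of the outer interior edges. With weights \<open>a\<close>, \<open>b\<close>, \<open>c\<close> of the interior edges, the other
  inequalities become \<open>m1 \<le> b + a - c\<close>, \<open>m2 \<le> b - a + c\<close>, \<open>m3 \<le> b + a + c\<close> and \<open>m4 \<le> b - a - c\<close>,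
  while the total weight is a constant plus \<open>b\<close>. Suitable \<open>a\<close> and \<open>c\<close> exist as soon as
  \<open>m1 + m2 \<le> 2 * b\<close> and \<open>m3 + m4 \<le> 2 * b\<close>. For the least such \<open>b\<close> the total is a tour value: the
  first bound gives the square, the second one the tetrahedron.\<close>

lemma exists_optimal_weight:
  assumes M: "\<And>v. v \<in> tour_values d \<Longrightarrow> v \<le> M"
  obtains w where "\<And>i j. (i, j) \<in> set pairs_lex \<Longrightarrow> d i j \<le> path_sum w i j"
    and "(\<Sum>k\<in>{1..9}. w k) \<le> M"
proof -
  have max_cases: "max u v = u \<or> max u v = v" for u v :: real
    by (simp add: max_def)
  have max4_cases: "max (max r s) (max t u) = r \<or> max (max r s) (max t u) = s
      \<or> max (max r s) (max t u) = t \<or> max (max r s) (max t u) = u" for r s t u :: real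
    using max_cases[of r s] max_cases[of t u] max_cases[of "max r s" "max t u"] by argo
  define x1 x2 x5 x6 where "x1 = (d 1 2 + d 1 3 - d 2 3) / 2" and "x2 = (d 1 2 + d 2 3 - d 1 3) / 2"
    and "x5 = (d 5 6 + d 4 5 - d 4 6) / 2" and "x6 = (d 5 6 + d 4 6 - d 4 5) / 2"
  define K L where "K = (d 1 3 + d 2 3 - d 1 2) / 2" and "L = (d 4 5 + d 4 6 - d 5 6) / 2"
  define m1 m2 m3 m4 where "m1 = max (d 1 4 - x1 - L) (d 2 4 - x2 - L)"
    and "m2 = max (d 3 5 - x5 - K) (d 3 6 - x6 - K)"
    and "m3 = max (max (d 1 5 - x1 - x5) (d 1 6 - x1 - x6)) (max (d 2 5 - x2 - x5) (d 2 6 - x2 - x6))"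
    and "m4 = d 3 4 - K - L"
  have local_eqs: "2 * x1 = d 1 2 + d 1 3 - d 2 3" "2 * x2 = d 1 2 + d 2 3 - d 1 3"
    "2 * x5 = d 5 6 + d 4 5 - d 4 6" "2 * x6 = d 5 6 + d 4 6 - d 4 5"
    "2 * K = d 1 3 + d 2 3 - d 1 2" "2 * L = d 4 5 + d 4 6 - d 5 6"
    by (simp_all add: x1_def x2_def x5_def x6_def K_def L_def)
  define b where "b = max ((m1 + m2) / 2) ((m3 + m4) / 2)"
  \<comment> \<open>Chosen to make the inequalities for \<open>m2\<close> and \<open>m4\<close> equalities.\<close>
  define a c where "a = b - (m2 + m4) / 2" and "c = (m2 - m4) / 2"
  have ac: "2 * a = 2 * b - m2 - m4" "2 * c = m2 - m4"
    by (simp_all add: a_def c_def field_simps)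
  define w where "w k = [x1, x2, K - a, L - c, x5, x6, a, b, c] ! (k - 1)" for k
  have w: "w 1 = x1" "w 2 = x2" "w 3 = K - a" "w 4 = L - c" "w 5 = x5" "w 6 = x6"
    "w 7 = a" "w 8 = b" "w 9 = c"
    by (simp_all add: w_def)
  have m1: "d 1 4 - x1 - L \<le> m1" "d 2 4 - x2 - L \<le> m1"
    "m1 = d 1 4 - x1 - L \<or> m1 = d 2 4 - x2 - L"
    unfolding m1_def by (rule max.cobounded1 max.cobounded2 max_cases)+
  have m2: "d 3 5 - x5 - K \<le> m2" "d 3 6 - x6 - K \<le> m2"
    "m2 = d 3 5 - x5 - K \<or> m2 = d 3 6 - x6 - K"
    unfolding m2_def by (rule max.cobounded1 max.cobounded2 max_cases)+
  have m3: "d 1 5 - x1 - x5 \<le> m3" "d 1 6 - x1 - x6 \<le> m3" "d 2 5 - x2 - x5 \<le> m3" "d 2 6 - x2 - x6 \<le> m3"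
    "m3 = d 1 5 - x1 - x5 \<or> m3 = d 1 6 - x1 - x6 \<or> m3 = d 2 5 - x2 - x5 \<or> m3 = d 2 6 - x2 - x6"
    unfolding m3_def by (auto simp only: le_max_iff_disj order_refl simp_thms max4_cases)
  have b: "m1 + m2 \<le> 2 * b" "m3 + m4 \<le> 2 * b" "2 * b = m1 + m2 \<or> 2 * b = m3 + m4"
    using max_cases[of "(m1 + m2) / 2" "(m3 + m4) / 2"] unfolding b_def by (auto simp: max_def)
  have half: "s \<le> 2 * M" if "(1/2) * s \<in> tour_values d" for s
    using M[OF that] by simp
  have tours:
    "d 1 2 + d 1 6 + d 2 3 + d 3 4 + d 4 5 + d 5 6 \<le> 2 * M"
    "d 1 2 + d 1 3 + d 2 6 + d 3 4 + d 4 5 + d 5 6 \<le> 2 * M"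
    "d 1 2 + d 1 4 + d 2 3 + d 3 6 + d 4 5 + d 5 6 \<le> 2 * M"
    "d 1 2 + d 1 3 + d 2 4 + d 3 6 + d 4 5 + d 5 6 \<le> 2 * M"
    "d 1 2 + d 1 5 + d 2 3 + d 3 4 + d 4 6 + d 5 6 \<le> 2 * M"
    "d 1 2 + d 1 3 + d 2 5 + d 3 4 + d 4 6 + d 5 6 \<le> 2 * M"
    "d 1 2 + d 1 4 + d 2 3 + d 3 5 + d 4 6 + d 5 6 \<le> 2 * M"
    "d 1 2 + d 1 3 + d 2 4 + d 3 5 + d 4 6 + d 5 6 \<le> 2 * M"
    by (rule half, simp add: tour_values_def)+
  have "(\<Sum>k\<in>{1..9}. w k) = d 1 2 + d 5 6 + K + L + b"
  proof -
    have "(\<Sum>k\<in>{1..9}. w k) = x1 + x2 + (K - a) + (L - c) + x5 + x6 + a + b + c"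
      unfolding atLeastAtMost_1_9 by (simp add: w del: One_nat_def)
    then show ?thesis
      using local_eqs by linarith
  qed
  also have "\<dots> \<le> M"
  proof -
    have "d 1 2 + d 5 6 + K + L + b \<le> M" if "2 * b = m1 + m2"
      by (insert that m1(3) m2(3) tours local_eqs, elim disjE; linarith)
    moreover have "d 1 2 + d 5 6 + K + L + b \<le> M" if "2 * b = m3 + m4"
      by (insert that m3(5) m4_def tours local_eqs, elim disjE; linarith)
    ultimately show ?thesis
      using b(3) by blast
  qed
  finally have total: "(\<Sum>k\<in>{1..9}. w k) \<le> M" .
  have "\<forall>(i, j)\<in>set pairs_lex. d i j \<le> path_sum w i j"
  proof -
    have
      "d 1 2 \<le> path_sum w 1 2" "d 1 3 \<le> path_sum w 1 3" "d 1 4 \<le> path_sum w 1 4"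
      "d 1 5 \<le> path_sum w 1 5" "d 1 6 \<le> path_sum w 1 6" "d 2 3 \<le> path_sum w 2 3"
      "d 2 4 \<le> path_sum w 2 4" "d 2 5 \<le> path_sum w 2 5" "d 2 6 \<le> path_sum w 2 6"
      "d 3 4 \<le> path_sum w 3 4" "d 3 5 \<le> path_sum w 3 5" "d 3 6 \<le> path_sum w 3 6"
      "d 4 5 \<le> path_sum w 4 5" "d 4 6 \<le> path_sum w 4 6" "d 5 6 \<le> path_sum w 5 6"
      unfolding path_sum_simps w using ac m1(1,2) m2(1,2) m3(1-4) m4_def b(1,2) local_eqs by linarith+
    then show ?thesis
      by (simp add: pairs_lex_def del: One_nat_def)
  qed
  then show ?thesis
    using that[of w] total by blast
qed

theorem mainTheorem4:
  fixes V :: "'v set" and E :: "'v set set" and M :: "'v set"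
    and p :: "nat \<Rightarrow> 'v" and \<rho> :: "'v \<Rightarrow> 'v \<Rightarrow> real" and d :: "nat \<Rightarrow> nat \<Rightarrow> real"
  assumes "Metric_space M \<rho>"
    and "bij_betw p {1..6} M"
    and "\<And>i j. d i j = \<rho> (p i) (p j)"
    and "binary_tree V E"
    and "boundary V E = M"
    and "moustaches V E = {{p 1, p 2}, {p 5, p 6}}"
    and "bij_betw (edge_partition V E) (interior_edges V E)
           {{{p 1, p 2}, {p 3, p 4, p 5, p 6}},
            {{p 1, p 2, p 3}, {p 4, p 5, p 6}},
            {{p 1, p 2, p 3, p 4}, {p 5, p 6}}}"
  shows "polyhedron (Lambda V E p)
    \<and> aff_dim (Lambda V E p) = 6
    \<and> card {x. x extreme_point_of Lambda V E p} = 8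
    \<and> {x. x extreme_point_of Lambda V E p} =
        {(1/2) *\<^sub>R vec_lex [1,0,0,0,1,1,0,0,0,1,0,0,1,0,1],
         (1/2) *\<^sub>R vec_lex [1,1,0,0,0,0,0,0,1,1,0,0,1,0,1],
         (1/2) *\<^sub>R vec_lex [1,0,1,0,0,1,0,0,0,0,0,1,1,0,1],
         (1/2) *\<^sub>R vec_lex [1,1,0,0,0,0,1,0,0,0,0,1,1,0,1],
         (1/2) *\<^sub>R vec_lex [1,0,0,1,0,1,0,0,0,1,0,0,0,1,1],
         (1/2) *\<^sub>R vec_lex [1,1,0,0,0,0,0,1,0,1,0,0,0,1,1],
         (1/2) *\<^sub>R vec_lex [1,0,1,0,0,1,0,0,0,0,1,0,0,1,1],
         (1/2) *\<^sub>R vec_lex [1,1,0,0,0,0,1,0,0,0,1,0,0,1,1]}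
    \<and> mpf_minus V E 6 p \<rho> = ereal (Max
        {(1/2) * (d 1 2 + d 1 6 + d 2 3 + d 3 4 + d 4 5 + d 5 6),
         (1/2) * (d 1 2 + d 1 3 + d 2 6 + d 3 4 + d 4 5 + d 5 6),
         (1/2) * (d 1 2 + d 1 4 + d 2 3 + d 3 6 + d 4 5 + d 5 6),
         (1/2) * (d 1 2 + d 1 3 + d 2 4 + d 3 6 + d 4 5 + d 5 6),
         (1/2) * (d 1 2 + d 1 5 + d 2 3 + d 3 4 + d 4 6 + d 5 6),
         (1/2) * (d 1 2 + d 1 3 + d 2 5 + d 3 4 + d 4 6 + d 5 6),
         (1/2) * (d 1 2 + d 1 4 + d 2 3 + d 3 5 + d 4 6 + d 5 6),
         (1/2) * (d 1 2 + d 1 3 + d 2 4 + d 3 5 + d 4 6 + d 5 6)})"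
proof -
  have tree: "tree V E"
    using assms(4) by (simp add: binary_tree_def)
  have bd: "p ` {1..6} \<subseteq> boundary V E"
    using assms(2,5) by (simp add: bij_betw_def)
  obtain e where e: "bij_betw e {1..9} E"
    and sep: "\<And>k i j. k \<in> {1..9} \<Longrightarrow> i \<in> {1..6} \<Longrightarrow> j \<in> {1..6} \<Longrightarrow>
           separates V E (e k) (p i) (p j) \<longleftrightarrow> (i \<in> side k) \<noteq> (j \<in> side k)"
    using six_leaf_tree_edges[OF assms(2) tree assms(5,7)] by blast
  have Lambda: "Lambda V E p = split_polytope"
    by (rule Lambda_eq_split_polytope[OF e sep])
  have "polyhedron split_polytope"
    unfolding split_polytope_eq_hull by (simp add: polyhedron_convex_hull)
  moreover have "card (vertex ` {..<8}) = 8"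
    by (simp add: card_image inj_on_vertex)
  moreover have "vertex ` {..<8} =
        {(1/2) *\<^sub>R vec_lex [1,0,0,0,1,1,0,0,0,1,0,0,1,0,1],
         (1/2) *\<^sub>R vec_lex [1,1,0,0,0,0,0,0,1,1,0,0,1,0,1],
         (1/2) *\<^sub>R vec_lex [1,0,1,0,0,1,0,0,0,0,0,1,1,0,1],
         (1/2) *\<^sub>R vec_lex [1,1,0,0,0,0,1,0,0,0,0,1,1,0,1],
         (1/2) *\<^sub>R vec_lex [1,0,0,1,0,1,0,0,0,1,0,0,0,1,1],
         (1/2) *\<^sub>R vec_lex [1,1,0,0,0,0,0,1,0,1,0,0,0,1,1],
         (1/2) *\<^sub>R vec_lex [1,0,1,0,0,1,0,0,0,0,1,0,0,1,1],
         (1/2) *\<^sub>R vec_lex [1,1,0,0,0,0,1,0,0,0,1,0,0,1,1]}"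
    unfolding lessThan_8 image_insert image_empty vertex_simps ..
  moreover have "mpf_minus V E 6 p \<rho> = ereal (Max (tour_values d))"
  proof -
    have filling: "generalized_filling V E 6 p \<rho> \<omega> \<longleftrightarrow>
        (\<forall>(i, j)\<in>set pairs_lex. d i j \<le> path_sum (\<lambda>k. \<omega> (e k)) i j)" for \<omega>
      unfolding assms(3) by (rule generalized_filling_iff_path_sums[OF tree bd e sep])
    have weight: "(\<Sum>f\<in>E. \<omega> f) = (\<Sum>k\<in>{1..9}. \<omega> (e k))" for \<omega> :: "'v set \<Rightarrow> real"
      using sum.reindex_bij_betw[OF e, of \<omega>] by simp
    have tours: "finite (tour_values d)" "tour_values d \<noteq> {}"
      by (simp_all add: tour_values_def)
    show ?thesis
      unfolding mpf_minus_def
    proof (rule antisym)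
      obtain w where w: "\<And>i j. (i, j) \<in> set pairs_lex \<Longrightarrow> d i j \<le> path_sum w i j"
        "(\<Sum>k\<in>{1..9}. w k) \<le> Max (tour_values d)"
        using exists_optimal_weight[of d "Max (tour_values d)"] tours(1) by (metis Max_ge)
      define \<omega> where "\<omega> f = w (inv_into {1..9} e f)" for f
      have \<omega>: "\<omega> (e k) = w k" if "k \<in> {1..9}" for k
        unfolding \<omega>_def using bij_betw_inv_into_left[OF e that] by simp
      have "path_sum (\<lambda>k. \<omega> (e k)) i j = path_sum w i j" for i j
        unfolding path_sum_def by (rule sum.cong) (simp_all only: \<omega>)
      then have "generalized_filling V E 6 p \<rho> \<omega>"
        unfolding filling using w(1) by auto
      moreover have "ereal (\<Sum>f\<in>E. \<omega> f) \<le> ereal (Max (tour_values d))"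
        unfolding weight using w(2) \<omega> by simp
      ultimately show "(INF \<omega>\<in>{\<omega>. generalized_filling V E 6 p \<rho> \<omega>}. ereal (\<Sum>f\<in>E. \<omega> f))
          \<le> ereal (Max (tour_values d))"
        by (intro INF_lower2[of \<omega>]) simp_all
    next
      show "ereal (Max (tour_values d))
          \<le> (INF \<omega>\<in>{\<omega>. generalized_filling V E 6 p \<rho> \<omega>}. ereal (\<Sum>f\<in>E. \<omega> f))"
      proof (rule INF_greatest)
        fix \<omega> assume "\<omega> \<in> {\<omega>. generalized_filling V E 6 p \<rho> \<omega>}"
        then have "v \<le> (\<Sum>f\<in>E. \<omega> f)" if "v \<in> tour_values d" for v
          unfolding weight mem_Collect_eq filling
          by (intro tour_value_le_weight[OF that]) blast
        then show "ereal (Max (tour_values d)) \<le> ereal (\<Sum>f\<in>E. \<omega> f)"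
          using tours by simp
      qed
    qed
  qed
  ultimately show ?thesis
    unfolding Lambda extreme_points_split_polytope tour_values_def
    using aff_dim_split_polytope by (intro conjI) (simp_all only:)
qed

end
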